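(* Let $F$ be a simple graph of order $n\ge2$, let $E_k=\{e_1,\ldots,e_k\}\subseteq E(F)$ with $|E_k|=k$, and suppose the subgraph $\mathscr E_k$ of $F$ induced by $E_k$ is $r$-regular. Let $H_{uv}$ and $H_{xy}$ be two disjoint simple graphs of order $m$ with specified edges $uv$ and $xy$ respectively, where $u,v$ have degree $m-1$ in $H_{uv}$ and $x,y$ have degree $m-1$ in $H_{xy}$, such that $H_{uv}-\{u,v\}$ and $H_{xy}-\{x,y\}$ are $r_2$-regular, where $m\ge3$ and $r_2\ge2$. If $H_{uv}$ and $H_{xy}$ are $Q$-cospectral, then $G[F,E_k,H_{uv}]$ and $G[F,E_k,H_{xy}]$ are $Q$-cospectral.
   Context: All graphs are finite and simple. $Q(X)=D(X)+A(X)$ is the signless Laplacian matrix of a graph $X$ ($D$ the diagonal degree matrix, $A$ the adjacency matrix). Two graphs are $Q$-cospectral if their signless Laplacian matrices have the same spectrum (with multiplicities). The subgraph induced by an edge set $E_k$ has edge set $E_k$ and vertex set the endpoints of edges in $E_k$. Graph with $k$ edge-pockets: $H_{uv}$ is a graph with a specified edge $uv$ such that $H_{uv}-u\cong H_{uv}-v$ (automatic when $u,v$ both have degree $m-1$). $G[F,E_k,H_{uv}]$ is obtained by taking one copy of $F$ and $k$ vertex-disjoint copies of $H_{uv}$, and, for each $i=1,\ldots,k$, pasting (identifying) the edge $uv$ of the $i$th copy of $H_{uv}$ with the edge $e_i$ of $F$; likewise for $H_{xy}$ with its edge $xy$. *)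

theory Defs
  imports "Jordan_Normal_Form.Char_Poly"
begin

record 'a sgraph =
  verts :: "'a set"
  edges :: "'a set set"

definition simple_graph :: "'a sgraph \<Rightarrow> bool" where
  "simple_graph X \<longleftrightarrow> finite (verts X) \<and> (\<forall>e\<in>edges X. e \<subseteq> verts X \<and> card e = 2)"

definition degree_of :: "'a sgraph \<Rightarrow> 'a \<Rightarrow> nat" where
  "degree_of X v = card {e \<in> edges X. v \<in> e}"

definition regular :: "nat \<Rightarrow> 'a sgraph \<Rightarrow> bool" where
  "regular r X \<longleftrightarrow> (\<forall>v\<in>verts X. degree_of X v = r)"

definition delete_verts :: "'a sgraph \<Rightarrow> 'a set \<Rightarrow> 'a sgraph" where
  "delete_verts X S = \<lparr>verts = verts X - S, edges = {e \<in> edges X. e \<inter> S = {}}\<rparr>"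

definition edge_induced :: "'a set set \<Rightarrow> 'a sgraph" where
  "edge_induced E = \<lparr>verts = \<Union>E, edges = E\<rparr>"

(* The matrices below are taken with respect to an enumeration vs of the vertices. *)

definition degree_mat :: "'a sgraph \<Rightarrow> 'a list \<Rightarrow> real mat" where
  "degree_mat X vs = mat (length vs) (length vs)
     (\<lambda>(i, j). if i = j then real (degree_of X (vs ! i)) else 0)"

definition adjacency_mat :: "'a sgraph \<Rightarrow> 'a list \<Rightarrow> real mat" where
  "adjacency_mat X vs = mat (length vs) (length vs)
     (\<lambda>(i, j). if {vs ! i, vs ! j} \<in> edges X then 1 else 0)"

definition signless_laplacian :: "'a sgraph \<Rightarrow> 'a list \<Rightarrow> real mat" where
  "signless_laplacian X vs = degree_mat X vs + adjacency_mat X vs"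

(* Spectrum with algebraic multiplicities.  The matrix is read over the complex numbers, so
   that no eigenvalue is lost by definition. *)
definition spectrum_mset :: "real mat \<Rightarrow> complex multiset" where
  "spectrum_mset A = proots (char_poly (map_mat complex_of_real A))"

(* A change of enumeration conjugates the matrix by a permutation matrix, so the spectrum does
   not depend on the one that is chosen. *)
definition Q_spectrum :: "'a sgraph \<Rightarrow> complex multiset" where
  "Q_spectrum X =
     spectrum_mset (signless_laplacian X (SOME vs. distinct vs \<and> set vs = verts X))"

definition Q_cospectral :: "'a sgraph \<Rightarrow> 'b sgraph \<Rightarrow> bool" where
  "Q_cospectral X Y \<longleftrightarrow> Q_spectrum X = Q_spectrum Y"

(* G[F, E, H_uv].  The copy of H belonging to e \<in> E has vertices (e, w); pasting its edge uv
   onto e identifies (e, u) with p e and (e, v) with q e, where p e and q e are the two ends of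
   e.  The functions p and q thus record the direction in which each copy is pasted. *)

definition paste :: "('a set \<Rightarrow> 'a) \<Rightarrow> ('a set \<Rightarrow> 'a) \<Rightarrow> 'b \<Rightarrow> 'b \<Rightarrow> 'a set \<Rightarrow> 'b
    \<Rightarrow> 'a + 'a set \<times> 'b" where
  "paste p q u v e w = (if w = u then Inl (p e) else if w = v then Inl (q e) else Inr (e, w))"

definition edge_pockets :: "'a sgraph \<Rightarrow> 'a set set \<Rightarrow> ('a set \<Rightarrow> 'a) \<Rightarrow> ('a set \<Rightarrow> 'a)
    \<Rightarrow> 'b sgraph \<Rightarrow> 'b \<Rightarrow> 'b \<Rightarrow> ('a + 'a set \<times> 'b) sgraph" where
  "edge_pockets F E p q H u v =
     \<lparr>verts = Inl ` verts F \<union> (\<Union>e\<in>E. paste p q u v e ` verts H),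
      edges = (image Inl) ` edges F \<union> (\<Union>e\<in>E. (image (paste p q u v e)) ` edges H)\<rparr>"

lemma simple_graph_edge_pockets:
  assumes F: "simple_graph F" and E: "E \<subseteq> edges F" and H: "simple_graph H"
    and pq: "\<forall>e\<in>E. e = {p e, q e}"
  shows "simple_graph (edge_pockets F E p q H u v)"
proof -
  have "edges F \<subseteq> Pow (verts F)" using F by (auto simp: simple_graph_def)
  then have finE: "finite E"
    using E F by (meson finite_Pow_iff finite_subset simple_graph_def)
  have inj: "inj (paste p q u v e)" if "e \<in> E" for e
  proof -
    have "card e = 2" using that E F by (auto simp: simple_graph_def)
    moreover have "e = {p e, q e}" using that pq by blast
    ultimately have "p e \<noteq> q e" by (metis card_2_iff doubleton_eq_iff insert_absorb2)
    then show ?thesis by (auto simp: inj_def paste_def)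
  qed
  have "card (paste p q u v e ` f) = 2" if "e \<in> E" "f \<in> edges H" for e f
    using card_image[OF inj_on_subset[OF inj[OF that(1)] subset_UNIV]] that H
    by (auto simp: simple_graph_def)
  moreover have "card (Inl ` f :: ('a + 'a set \<times> 'b) set) = 2" if "f \<in> edges F" for f
    using that F by (auto simp: simple_graph_def card_image)
  ultimately show ?thesis
    using F H finE by (fastforce simp: simple_graph_def edge_pockets_def)
qed

end

theory Submission
  imports Defs
begin

text \<open>
  In the matrix t - Q(G) of a graph with pockets, every copy of the core H - {u, v} contributes a
  diagonal block D(t) = (t - 2) - Q(H - {u, v}), and all rows of this block have the sum
  t - 2 - 2 s, where s is the valency of the core. A core vertex is joined exactly to the two ends
  of its edge, so the all-ones vectors of the cores are all that is needed to eliminate them: the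
  Schur complement on F depends only on t, F, the pasted edges, m and s, and the remaining factor
  is a power of det D(t). The same elimination applied to H itself expresses the characteristic
  polynomial of Q(H) as a known factor times det D(t). This factor is nonzero for large t, so
  Q-cospectral H and K have equal det D(t), and hence the two graphs with pockets have
  characteristic polynomials that agree for all large t.
\<close>

section \<open>Determinants of matrices with rows and columns indexed by lists\<close>

definition list_mat :: "'c list \<Rightarrow> 'd list \<Rightarrow> ('c \<Rightarrow> 'd \<Rightarrow> 'a) \<Rightarrow> 'a mat" where
  "list_mat xs ys f = mat (length xs) (length ys) (\<lambda>(i, j). f (xs ! i) (ys ! j))"

lemma list_mat_carrier [simp]: "list_mat xs ys f \<in> carrier_mat (length xs) (length ys)"
  by (simp add: list_mat_def)

lemma list_mat_cong:
  "(\<And>a b. a \<in> set xs \<Longrightarrow> b \<in> set ys \<Longrightarrow> f a b = g a b) \<Longrightarrow> list_mat xs ys f = list_mat xs ys g"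
  by (auto simp: list_mat_def intro!: eq_matI)

lemma list_mat_map: "list_mat (map h xs) (map h' ys) f = list_mat xs ys (\<lambda>a b. f (h a) (h' b))"
  by (auto simp: list_mat_def intro!: eq_matI)

lemma list_mat_append:
  "list_mat (xs @ ys) (xs' @ ys') f =
     four_block_mat (list_mat xs xs' f) (list_mat xs ys' f) (list_mat ys xs' f) (list_mat ys ys' f)"
  by (rule eq_matI) (auto simp: list_mat_def nth_append)

lemma list_mat_mult:
  fixes f :: "'c \<Rightarrow> 'd \<Rightarrow> 'a::comm_semiring_0"
  assumes "distinct ys"
  shows "list_mat xs ys f * list_mat ys zs g = list_mat xs zs (\<lambda>a c. \<Sum>b\<in>set ys. f a b * g b c)"
proof (rule eq_matI)
  fix i j assume "i < dim_row (list_mat xs zs (\<lambda>a c. \<Sum>b\<in>set ys. f a b * g b c))"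
    "j < dim_col (list_mat xs zs (\<lambda>a c. \<Sum>b\<in>set ys. f a b * g b c))"
  then show "(list_mat xs ys f * list_mat ys zs g) $$ (i, j) =
      list_mat xs zs (\<lambda>a c. \<Sum>b\<in>set ys. f a b * g b c) $$ (i, j)"
    by (simp add: list_mat_def scalar_prod_def sum.distinct_set_conv_list[OF assms]
        interv_sum_list_conv_sum_set_nat sum_list_sum_nth)
qed (auto simp: list_mat_def)

lemma det_list_mat_pair:
  fixes f :: "'c \<Rightarrow> 'c \<Rightarrow> 'a::comm_ring_1"
  shows "det (list_mat [a, b] [a, b] f) = f a a * f b b - f a b * f b a"
proof -
  have carrier: "list_mat [a, b] [a, b] f \<in> carrier_mat 2 2"
    by (auto simp: list_mat_def)
  show ?thesis
    unfolding laplace_expansion_row[OF carrier, of 0, simplified]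
    by (simp add: cofactor_def det_single mat_delete_def list_mat_def numeral_2_eq_2)
qed

text \<open>Rows and columns undergo the same permutation, so its sign enters twice and cancels.
  Hence a determinant indexed by vertices does not depend on their enumeration, and cores can be
  listed last.\<close>

lemma det_list_mat_reorder:
  fixes f :: "'c \<Rightarrow> 'c \<Rightarrow> 'a::comm_ring_1"
  assumes "mset xs = mset ys"
  shows "det (list_mat xs xs f) = det (list_mat ys ys f)"
proof -
  let ?n = "length ys"
  obtain \<pi> where \<pi>: "\<pi> permutes {..<?n}" and xs: "permute_list \<pi> ys = xs"
    using assms by (rule mset_eq_permutation)
  have \<pi>0: "\<pi> permutes {0..<?n}" using \<pi> by (simp add: lessThan_atLeast0)
  have lt: "\<pi> i < ?n" if "i < ?n" for i using permutes_in_image[OF \<pi>] that by auto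
  have len: "length xs = ?n" using assms by (rule mset_eq_length)
  have nth: "xs ! i = ys ! \<pi> i" if "i < ?n" for i
    using permute_list_nth[OF \<pi> that] xs by simp
  have sq: "list_mat xs' ys' g \<in> carrier_mat ?n ?n" if "length xs' = ?n" "length ys' = ?n"
    for xs' ys' :: "'c list" and g :: "'c \<Rightarrow> 'c \<Rightarrow> 'a"
    using list_mat_carrier[of xs' ys' g] that by simp
  have rows: "det (list_mat xs zs g) = signof \<pi> * det (list_mat ys zs g)" if "length zs = ?n"
    for zs :: "'c list" and g :: "'c \<Rightarrow> 'c \<Rightarrow> 'a"
  proof -
    have "list_mat xs zs g = mat ?n ?n (\<lambda>(i, j). list_mat ys zs g $$ (\<pi> i, j))"
      by (rule eq_matI) (auto simp: list_mat_def that len nth lt)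
    then show ?thesis using det_permute_rows[OF sq[OF refl that] \<pi>0] by simp
  qed
  \<comment> \<open>Transposition turns the permutation of columns into one of rows, so
    \<open>rows\<close> serves for both.\<close>
  have transpose: "det (list_mat as bs g) = det (list_mat bs as (\<lambda>a b. g b a))"
    if "length as = ?n" "length bs = ?n" for as bs :: "'c list" and g :: "'c \<Rightarrow> 'c \<Rightarrow> 'a"
  proof -
    have "transpose_mat (list_mat as bs g) = list_mat bs as (\<lambda>a b. g b a)"
      by (rule eq_matI) (auto simp: list_mat_def)
    then show ?thesis using det_transpose[OF sq[OF that]] by metis
  qed
  have "det (list_mat xs xs f) = signof \<pi> * det (list_mat ys xs f)" using rows len by simp
  also have "det (list_mat ys xs f) = signof \<pi> * det (list_mat ys ys f)"
    using transpose[of ys xs f] transpose[of ys ys "\<lambda>a b. f b a"] rows[of ys "\<lambda>a b. f b a"] len by simp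
  also have "signof \<pi> * (signof \<pi> * det (list_mat ys ys f)) = det (list_mat ys ys f)"
    by (simp add: sign_def)
  finally show ?thesis .
qed

text \<open>With X a solution of D X = C in place of the product of the inverse of D and C, the Schur
  complement formula holds without invertibility of D.\<close>

lemma det_list_mat_Schur:
  fixes f :: "'c \<Rightarrow> 'c \<Rightarrow> 'a::idom"
  assumes "distinct ys"
    and X: "\<And>y x. y \<in> set ys \<Longrightarrow> x \<in> set xs \<Longrightarrow> (\<Sum>z\<in>set ys. f y z * X z x) = f y x"
  shows "det (list_mat (xs @ ys) (xs @ ys) f) =
     det (list_mat xs xs (\<lambda>a b. f a b - (\<Sum>z\<in>set ys. f a z * X z b))) * det (list_mat ys ys f)"
proof -
  let ?n = "length xs" and ?m = "length ys"
  let ?A = "list_mat xs xs f" and ?B = "list_mat xs ys f" and ?C = "list_mat ys xs f"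
    and ?D = "list_mat ys ys f" and ?X = "list_mat ys xs (\<lambda>a b. - X a b)"
  let ?S = "list_mat xs xs (\<lambda>a b. f a b - (\<Sum>z\<in>set ys. f a z * X z b))"
  \<comment> \<open>Right multiplication by \<open>?T\<close> is a unimodular column operation: it
    clears the lower left block, because D X = C, and leaves the Schur complement in the upper
    left.\<close>
  let ?T = "four_block_mat (1\<^sub>m ?n) (0\<^sub>m ?n ?m) ?X (1\<^sub>m ?m)"
  have "?A * 1\<^sub>m ?n + ?B * ?X = ?S"
    unfolding list_mat_mult[OF assms(1)] right_mult_one_mat[OF list_mat_carrier]
    by (rule eq_matI) (auto simp: list_mat_def sum_negf)
  moreover have "?C * 1\<^sub>m ?n + ?D * ?X = 0\<^sub>m ?m ?n"
    unfolding list_mat_mult[OF assms(1)] right_mult_one_mat[OF list_mat_carrier]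
    by (rule eq_matI) (auto simp: list_mat_def sum_negf X)
  ultimately have prod: "list_mat (xs @ ys) (xs @ ys) f * ?T = four_block_mat ?S ?B (0\<^sub>m ?m ?n) ?D"
    unfolding list_mat_append
    by (subst mult_four_block_mat[OF list_mat_carrier list_mat_carrier list_mat_carrier
          list_mat_carrier one_carrier_mat zero_carrier_mat list_mat_carrier one_carrier_mat])
       (simp_all add: right_mult_one_mat[OF list_mat_carrier] right_mult_zero_mat[OF list_mat_carrier]
         left_add_zero_mat[OF list_mat_carrier])
  have "det ?T = 1"
    by (subst det_four_block_mat_upper_right_zero[where n = ?n and m = ?m]) simp_all
  moreover have "det (list_mat (xs @ ys) (xs @ ys) f * ?T) =
      det (list_mat (xs @ ys) (xs @ ys) f) * det ?T"
    by (rule det_mult[where n = "?n + ?m"]) (use list_mat_carrier[of "xs @ ys" "xs @ ys" f] in auto)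
  ultimately show ?thesis
    unfolding prod by (simp add: det_four_block_mat_lower_left_zero[where n = ?n and m = ?m])
qed

text \<open>Here \<open>h e w\<close> stands for the copy of \<open>w\<close> in the block
  \<open>e\<close>. Each induction step splits off one block; the zero block below it makes the
  determinant a product.\<close>

lemma det_list_mat_block_diagonal:
  fixes f :: "'c \<Rightarrow> 'c \<Rightarrow> 'a::idom"
  assumes "distinct es"
    and "\<And>e e' w w'. e \<in> set es \<Longrightarrow> e' \<in> set es \<Longrightarrow> w \<in> set ws \<Longrightarrow> w' \<in> set ws \<Longrightarrow>
           f (h e w) (h e' w') = (if e = e' then g w w' else 0)"
  defines "ys \<equiv> \<lambda>es. concat (map (\<lambda>e. map (h e) ws) es)"
  shows "det (list_mat (ys es) (ys es) f) = det (list_mat ws ws g) ^ length es"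
  using assms(1,2)
proof (induction es)
  case Nil
  have "list_mat (ys []) (ys []) f \<in> carrier_mat 0 0"
    using list_mat_carrier[of "ys []" "ys []" f] by (simp add: ys_def)
  then show ?case by simp
next
  case (Cons e es)
  have ys: "ys (e # es) = map (h e) ws @ ys es" by (simp add: ys_def)
  have "list_mat (ys es) (map (h e) ws) f = 0\<^sub>m (length (ys es)) (length (map (h e) ws))"
  proof -
    have "list_mat (ys es) (map (h e) ws) f = list_mat (ys es) (map (h e) ws) (\<lambda>_ _. 0)"
      using Cons.prems by (intro list_mat_cong) (auto simp: ys_def)
    then show ?thesis by (auto simp: list_mat_def)
  qed
  moreover have "list_mat (map (h e) ws) (map (h e) ws) f = list_mat ws ws g"
    unfolding list_mat_map using Cons.prems by (intro list_mat_cong) auto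
  moreover have "det (list_mat (ys es) (ys es) f) = det (list_mat ws ws g) ^ length es"
    using Cons by simp
  ultimately show ?case
    unfolding ys list_mat_append
    by (subst det_four_block_mat_lower_left_zero[OF list_mat_carrier list_mat_carrier _ list_mat_carrier])
       simp_all
qed

section \<open>Degrees, adjacency and the characteristic polynomial of Q\<close>

lemma degree_of_neighbours:
  assumes "simple_graph X"
  shows "degree_of X a = card {b. {a, b} \<in> edges X}"
proof -
  have "{e \<in> edges X. a \<in> e} = (\<lambda>b. {a, b}) ` {b. {a, b} \<in> edges X}"
  proof -
    have "\<exists>b. e = {a, b}" if "e \<in> edges X" "a \<in> e" for e
      using that assms by (auto simp: simple_graph_def card_2_iff)
    then show ?thesis by blast
  qed
  moreover have "inj_on (\<lambda>b. {a, b}) {b. {a, b} \<in> edges X}"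
    by (auto simp: inj_on_def doubleton_eq_iff)
  ultimately show ?thesis by (simp add: degree_of_def card_image)
qed

lemma simple_graph_adjD:
  assumes "simple_graph X" "{a, b} \<in> edges X"
  shows "a \<in> verts X" "b \<in> verts X" "a \<noteq> b"
  using assms by (auto simp: simple_graph_def)

text \<open>This is the entry of t I - Q(X), addressed by vertices instead of positions. Fixing a
  real t keeps the entries in a field, so the elimination below may divide by t - 2 - 2 s.\<close>

definition char_entry :: "'c sgraph \<Rightarrow> real \<Rightarrow> 'c \<Rightarrow> 'c \<Rightarrow> real" where
  "char_entry X t a b =
     (if a = b then t - real (degree_of X a) else 0) - of_bool ({a, b} \<in> edges X)"

definition Q_poly :: "'c sgraph \<Rightarrow> real poly" where
  "Q_poly X = char_poly (signless_laplacian X (SOME vs. distinct vs \<and> set vs = verts X))"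

lemma Q_poly_monic: "lead_coeff (Q_poly X) = 1"
proof -
  have "signless_laplacian X vs \<in> carrier_mat (length vs) (length vs)" for vs
    by (simp add: signless_laplacian_def degree_mat_def adjacency_mat_def)
  then show ?thesis unfolding Q_poly_def using degree_monic_char_poly by metis
qed

lemma poly_Q_poly:
  assumes "distinct vs" "set vs = verts X"
  shows "poly (Q_poly X) t = det (list_mat vs vs (char_entry X t))"
proof -
  define ws where "ws = (SOME vs. distinct vs \<and> set vs = verts X)"
  have ws: "distinct ws" "set ws = verts X"
    unfolding ws_def using someI[of "\<lambda>vs. distinct vs \<and> set vs = verts X" vs] assms by auto
  have Q: "signless_laplacian X ws \<in> carrier_mat (length ws) (length ws)"
    by (simp add: signless_laplacian_def degree_mat_def adjacency_mat_def)
  \<comment> \<open>\<open>char_matrix\<close> is Q - t I, hence the minus sign.\<close>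
  have "- char_matrix (signless_laplacian X ws) t = list_mat ws ws (char_entry X t)"
    by (rule eq_matI)
       (use ws in \<open>auto simp: char_matrix_def list_mat_def char_entry_def signless_laplacian_def
         degree_mat_def adjacency_mat_def nth_eq_iff_index_eq\<close>)
  then have "poly (Q_poly X) t = det (list_mat ws ws (char_entry X t))"
    unfolding Q_poly_def ws_def[symmetric] char_poly_matrix[OF Q] by simp
  also have "\<dots> = det (list_mat vs vs (char_entry X t))"
    using ws assms by (intro det_list_mat_reorder) (simp add: set_eq_iff_mset_eq_distinct[symmetric])
  finally show ?thesis .
qed

text \<open>Over the complex numbers a monic polynomial is recovered from its multiset of roots, and
  the embedding of real into complex polynomials is injective.\<close>

lemma Q_cospectral_iff_Q_poly: "Q_cospectral X Y \<longleftrightarrow> Q_poly X = Q_poly Y"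
proof -
  interpret of_real_poly: map_poly_inj_comm_ring_hom complex_of_real ..
  have spectrum: "Q_spectrum Z = proots (map_poly complex_of_real (Q_poly Z))" for Z :: "'z sgraph"
    unfolding Q_spectrum_def spectrum_mset_def Q_poly_def
    by (subst of_real_hom.char_poly_hom)
       (auto simp: signless_laplacian_def degree_mat_def adjacency_mat_def)
  have decompose: "map_poly complex_of_real (Q_poly Z) = (\<Prod>a\<in>#Q_spectrum Z. [:- a, 1:])"
    for Z :: "'z sgraph"
    using complex_poly_decompose_multiset[of "map_poly complex_of_real (Q_poly Z)"]
      Q_poly_monic[of Z]
    by (simp add: spectrum)
  show ?thesis
    unfolding Q_cospectral_def
    using decompose[of X] decompose[of Y] spectrum[of X] spectrum[of Y] by auto
qed

section \<open>One pocket: two ends of full degree and a regular core\<close>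

locale pocket =
  fixes H :: "'b sgraph" and u v :: 'b and m s :: nat
  assumes simple_H: "simple_graph H"
    and card_H: "card (verts H) = m"
    and edge_uv: "{u, v} \<in> edges H"
    and degree_u: "degree_of H u = m - 1"
    and degree_v: "degree_of H v = m - 1"
    and regular_core: "regular s (delete_verts H {u, v})"
begin

abbreviation W :: "'b set" where
  "W \<equiv> verts H - {u, v}"

lemma finite_H: "finite (verts H)"
  using simple_H by (simp add: simple_graph_def)

lemma ends: "u \<in> verts H" "v \<in> verts H" "u \<noteq> v"
  using simple_graph_adjD[OF simple_H edge_uv] by auto

lemma card_W: "card W = m - 2"
  using ends finite_H card_H by (simp add: card_Diff_subset)

text \<open>The neighbourhood lies in \<open>verts H - {a}\<close> and has as many elements as that
  set, so the two coincide.\<close>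

lemma full_degree_adj:
  assumes "a \<in> verts H" "degree_of H a = m - 1"
  shows "{a, b} \<in> edges H \<longleftrightarrow> b \<in> verts H \<and> a \<noteq> b"
proof -
  have "{b. {a, b} \<in> edges H} = verts H - {a}"
  proof (rule card_subset_eq)
    show "{b. {a, b} \<in> edges H} \<subseteq> verts H - {a}"
      using simple_graph_adjD[OF simple_H] by blast
    show "card {b. {a, b} \<in> edges H} = card (verts H - {a})"
      using degree_of_neighbours[OF simple_H, of a] assms card_H by simp
  qed (use finite_H in simp)
  then show ?thesis by auto
qed

lemmas adj_u = full_degree_adj[OF ends(1) degree_u]
lemmas adj_v = full_degree_adj[OF ends(2) degree_v]

lemma card_core_neighbours:
  assumes "w \<in> W"
  shows "card {w' \<in> W. {w, w'} \<in> edges H} = s"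
proof -
  have "simple_graph (delete_verts H {u, v})"
    using simple_H by (auto simp: simple_graph_def delete_verts_def)
  then have "degree_of (delete_verts H {u, v}) w =
      card {w'. {w, w'} \<in> edges (delete_verts H {u, v})}"
    by (rule degree_of_neighbours)
  also have "{w'. {w, w'} \<in> edges (delete_verts H {u, v})} = {w' \<in> W. {w, w'} \<in> edges H}"
    using assms simple_graph_adjD[OF simple_H] by (auto simp: delete_verts_def)
  finally show ?thesis
    using regular_core assms by (simp add: regular_def delete_verts_def)
qed

lemma degree_W:
  assumes "w \<in> W"
  shows "degree_of H w = s + 2"
proof -
  have "{w'. {w, w'} \<in> edges H} = {w' \<in> W. {w, w'} \<in> edges H} \<union> {u, v}"
    using assms simple_graph_adjD[OF simple_H] adj_u[of w] adj_v[of w] by (auto simp: insert_commute)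
  moreover have "card ({w' \<in> W. {w, w'} \<in> edges H} \<union> {u, v}) =
      card {w' \<in> W. {w, w'} \<in> edges H} + 2"
    using ends finite_H by (subst card_Un_disjoint) auto
  ultimately show ?thesis
    by (simp only: degree_of_neighbours[OF simple_H] card_core_neighbours[OF assms])
qed

text \<open>This is the block D(t) of the introduction, with the degree s + 2 of a core vertex
  inserted. Pasting does not change these degrees, so the same block serves \<open>H\<close> and
  every copy of it.\<close>

definition core_entry :: "real \<Rightarrow> 'b \<Rightarrow> 'b \<Rightarrow> real" where
  "core_entry t a b = (if a = b then t - (real s + 2) else 0) - of_bool ({a, b} \<in> edges H)"

text \<open>Both characteristic polynomials below see the inner structure of the core only through
  this number. The chosen enumeration is immaterial by \<open>core_det_list\<close>.\<close>

definition core_det :: "real \<Rightarrow> real" where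
  "core_det t = (let ws = SOME ws. distinct ws \<and> set ws = W in det (list_mat ws ws (core_entry t)))"

lemma core_det_list:
  assumes "distinct ws" "set ws = W"
  shows "det (list_mat ws ws (core_entry t)) = core_det t"
proof -
  define ws' where "ws' = (SOME ws. distinct ws \<and> set ws = W)"
  have "distinct ws' \<and> set ws' = W"
    unfolding ws'_def by (rule someI[of _ ws]) (use assms in simp)
  then show ?thesis
    unfolding core_det_def ws'_def[symmetric] Let_def using assms
    by (intro det_list_mat_reorder) (simp add: set_eq_iff_mset_eq_distinct[symmetric])
qed

text \<open>The diagonal gives t - (s + 2) and the s core neighbours give -1 each. So the all-ones
  vector is an eigenvector of the block, which solves the linear systems of the Schur complement
  explicitly.\<close>

lemma core_entry_row_sum:
  assumes "w \<in> W"
  shows "(\<Sum>w'\<in>W. core_entry t w w') = t - 2 - 2 * real s"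
proof -
  have "(\<Sum>w'\<in>W. of_bool ({w, w'} \<in> edges H) :: real) = real (card {w' \<in> W. {w, w'} \<in> edges H})"
    using finite_H by (subst sum_of_bool_eq) (auto simp: Int_def)
  then have "(\<Sum>w'\<in>W. of_bool ({w, w'} \<in> edges H) :: real) = real s"
    by (simp only: card_core_neighbours[OF assms])
  then show ?thesis
    using assms finite_H by (simp add: core_entry_def sum_subtractf)
qed

text \<open>Eliminating the core leaves a 2 by 2 matrix on the ends with diagonal t - (m - 1) - c
  and off-diagonal -(1 + c). Its determinant depends only on t, m and s.\<close>

lemma poly_Q_poly_H:
  assumes "t \<noteq> 2 + 2 * real s"
  defines "c \<equiv> real (m - 2) / (t - 2 - 2 * real s)"
  shows "poly (Q_poly H) t = ((t - real (m - 1) - c)\<^sup>2 - (1 + c)\<^sup>2) * core_det t"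
proof -
  obtain ws where ws: "distinct ws" "set ws = W"
    using finite_distinct_list[of W] finite_H by auto
  let ?f = "char_entry H t"
  \<comment> \<open>The columns joining the core to its ends are constantly -1 and the core rows sum
    to t - 2 - 2 s, so this constant solves D X = C.\<close>
  let ?X = "\<lambda>_ _ :: 'b. - 1 / (t - 2 - 2 * real s)"
  have core: "?f w w' = core_entry t w w'" if "w \<in> W" for w w'
    using degree_W[OF that] by (auto simp: char_entry_def core_entry_def)
  have ends_W: "?f a w = -1 \<and> ?f w a = -1" if "w \<in> W" "a \<in> {u, v}" for w a
    using that adj_u[of w] adj_v[of w] by (auto simp: char_entry_def insert_commute)
  have "poly (Q_poly H) t = det (list_mat ([u, v] @ ws) ([u, v] @ ws) ?f)"
    using ws ends by (intro poly_Q_poly) auto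
  also have "\<dots> = det (list_mat [u, v] [u, v] (\<lambda>a b. ?f a b - (\<Sum>z\<in>set ws. ?f a z * ?X z b)))
      * det (list_mat ws ws ?f)"
  proof (rule det_list_mat_Schur[OF ws(1)])
    fix y x assume yx: "y \<in> set ws" "x \<in> set [u, v]"
    have "(\<Sum>z\<in>set ws. ?f y z * ?X z x) = (\<Sum>z\<in>W. core_entry t y z) * (- 1 / (t - 2 - 2 * real s))"
      using yx ws core by (simp add: sum_negf sum_divide_distrib)
    then show "(\<Sum>z\<in>set ws. ?f y z * ?X z x) = ?f y x"
      using assms yx ws ends_W[of y x] core_entry_row_sum[of y t] by simp
  qed
  also have "det (list_mat ws ws ?f) = core_det t"
    using core_det_list[OF ws] list_mat_cong[of ws ws ?f "core_entry t"] core ws by simp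
  also have "list_mat [u, v] [u, v] (\<lambda>a b. ?f a b - (\<Sum>z\<in>set ws. ?f a z * ?X z b)) =
      list_mat [u, v] [u, v] (\<lambda>a b. if a = b then t - real (m - 1) - c else - (1 + c))"
  proof (rule list_mat_cong)
    fix a b assume ab: "a \<in> set [u, v]" "b \<in> set [u, v]"
    have "(\<Sum>z\<in>set ws. ?f a z * ?X z b) = (\<Sum>z\<in>W. 1 / (t - 2 - 2 * real s))"
      unfolding ws(2) by (rule sum.cong) (use ab ends_W in auto)
    also have "\<dots> = c" by (simp add: c_def card_W)
    finally show "?f a b - (\<Sum>z\<in>set ws. ?f a z * ?X z b) =
        (if a = b then t - real (m - 1) - c else - (1 + c))"
      using ab ends edge_uv adj_u[of u] adj_v[of v]
      by (auto simp: char_entry_def degree_u degree_v insert_commute)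
  qed
  also have "det \<dots> = (t - real (m - 1) - c)\<^sup>2 - (1 + c)\<^sup>2"
    using ends by (simp add: det_list_mat_pair power2_eq_square algebra_simps)
  finally show ?thesis .
qed

end

section \<open>Adjacency, degrees and elimination of cores in the graph with pockets\<close>

locale pocketed_graph = pocket H u v m s
  for H :: "'b sgraph" and u v :: 'b and m s :: nat +
  fixes F :: "'a sgraph" and E :: "'a set set" and p q :: "'a set \<Rightarrow> 'a"
  assumes simple_F: "simple_graph F"
    and E: "E \<subseteq> edges F"
    and pq: "\<And>e. e \<in> E \<Longrightarrow> e = {p e, q e}"
begin

abbreviation G :: "('a + 'a set \<times> 'b) sgraph" where
  "G \<equiv> edge_pockets F E p q H u v"

lemma simple_G: "simple_graph G"
  using simple_graph_edge_pockets[OF simple_F E simple_H] pq by blast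

lemma finite_E: "finite E"
proof -
  have "edges F \<subseteq> Pow (verts F)" using simple_F by (auto simp: simple_graph_def)
  then show ?thesis using E simple_F by (meson finite_Pow_iff finite_subset simple_graph_def)
qed

lemma pq_verts: "e \<in> E \<Longrightarrow> p e \<in> verts F \<and> q e \<in> verts F \<and> p e \<noteq> q e"
  using simple_graph_adjD[OF simple_F] pq E by (metis in_mono)

lemma verts_G: "verts G = Inl ` verts F \<union> Inr ` (E \<times> W)"
  using pq_verts ends by (auto simp: edge_pockets_def paste_def image_iff split: if_splits)

text \<open>A pasted edge with both ends in \<open>F\<close> can only be the image of uv, and this
  image is the edge e of \<open>F\<close> onto which it is pasted.\<close>

lemma adj_Inl_Inl: "{Inl a, Inl b} \<in> edges G \<longleftrightarrow> {a, b} \<in> edges F"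
proof
  assume "{Inl a, Inl b} \<in> edges G"
  then consider f where "f \<in> edges F" "{Inl a, Inl b} = (Inl ` f :: ('a + 'a set \<times> 'b) set)"
    | e f where "e \<in> E" "f \<in> edges H" "{Inl a, Inl b} = paste p q u v e ` f"
    by (auto simp: edge_pockets_def)
  then show "{a, b} \<in> edges F"
  proof cases
    case 1
    have "(Inl ` {a, b} :: ('a + 'a set \<times> 'b) set) = Inl ` f" using 1 by simp
    then show ?thesis using 1 by (metis inj_image_eq_iff inj_Inl)
  next
    case 2
    obtain w w' where f: "f = {w, w'}" "w \<noteq> w'"
      using 2 simple_H by (auto simp: simple_graph_def card_2_iff)
    \<comment> \<open>\<open>paste\<close> sends every vertex other than \<open>u\<close> and
      \<open>v\<close> to an \<open>Inr\<close> value.\<close>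
    have "{w, w'} \<subseteq> {u, v}"
      using 2(3) f by (auto simp: paste_def doubleton_eq_iff split: if_splits)
    then have "{Inl a, Inl b} = (Inl ` {p e, q e} :: ('a + 'a set \<times> 'b) set)"
      using 2(3) f ends by (auto simp: paste_def)
    then have "{a, b} = {p e, q e}" by (auto simp: doubleton_eq_iff)
    then show ?thesis using 2 pq E by auto
  qed
next
  assume "{a, b} \<in> edges F"
  then have "Inl ` {a, b} \<in> edges G" unfolding edge_pockets_def by (auto simp del: image_insert)
  then show "{Inl a, Inl b} \<in> edges G" by simp
qed

lemma pasted_edge:
  assumes "e \<in> E" "{w, w'} \<in> edges H"
  shows "{paste p q u v e w, paste p q u v e w'} \<in> edges G"
proof -
  have "paste p q u v e ` {w, w'} \<in> edges G"
    using assms unfolding edge_pockets_def by (auto simp del: image_insert)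
  then show ?thesis by simp
qed

text \<open>The label e of a core vertex names the only copy that contains it, so every edge at this
  vertex comes from that copy.\<close>

lemma edge_Inr_E:
  assumes "{Inr (e, w), z} \<in> edges G"
  obtains w' where "e \<in> E" "w \<in> W" "{w, w'} \<in> edges H" "z = paste p q u v e w'"
proof -
  obtain e' f where f: "e' \<in> E" "f \<in> edges H" "{Inr (e, w), z} = paste p q u v e' ` f"
    using assms by (auto simp: edge_pockets_def)
  obtain a b where "f = {a, b}"
    using f simple_H by (auto simp: simple_graph_def card_2_iff)
  then obtain w' b where w: "{w', b} \<in> edges H" "Inr (e, w) = paste p q u v e' w'"
      "z = paste p q u v e' b"
    using f(2,3) by (auto simp: doubleton_eq_iff insert_commute)
  then have "e = e'" "w = w'" "w \<notin> {u, v}" by (auto simp: paste_def split: if_splits)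
  then show ?thesis using that w f simple_graph_adjD(1)[OF simple_H w(1)] by blast
qed

text \<open>A core vertex is joined to both \<open>u\<close> and \<open>v\<close>, hence to both
  ends of e. The direction of pasting recorded by \<open>p\<close> and \<open>q\<close> therefore
  leaves no trace in the adjacency.\<close>

lemma adj_Inr_Inl: "{Inr (e, w), Inl a} \<in> edges G \<longleftrightarrow> e \<in> E \<and> w \<in> W \<and> a \<in> e"
proof
  assume "{Inr (e, w), Inl a} \<in> edges G"
  then obtain w' where "e \<in> E" "w \<in> W" "Inl a = paste p q u v e w'" by (rule edge_Inr_E)
  then show "e \<in> E \<and> w \<in> W \<and> a \<in> e" using pq[of e] by (auto simp: paste_def split: if_splits)
next
  assume *: "e \<in> E \<and> w \<in> W \<and> a \<in> e"
  then have "a = p e \<or> a = q e" using pq[of e] by blast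
  then show "{Inr (e, w), Inl a} \<in> edges G"
    using pasted_edge[of e w u] pasted_edge[of e w v] * adj_u[of w] adj_v[of w] ends
    by (auto simp: paste_def insert_commute)
qed

lemma adj_Inr_Inr:
  "{Inr (e, w), Inr (e', w')} \<in> edges G \<longleftrightarrow>
     e \<in> E \<and> e = e' \<and> w \<in> W \<and> w' \<in> W \<and> {w, w'} \<in> edges H"
proof
  assume "{Inr (e, w), Inr (e', w')} \<in> edges G"
  then obtain b where "e \<in> E" "w \<in> W" "{w, b} \<in> edges H" "Inr (e', w') = paste p q u v e b"
    by (rule edge_Inr_E)
  then show "e \<in> E \<and> e = e' \<and> w \<in> W \<and> w' \<in> W \<and> {w, w'} \<in> edges H"
    using simple_graph_adjD[OF simple_H] by (auto simp: paste_def split: if_splits)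
next
  assume "e \<in> E \<and> e = e' \<and> w \<in> W \<and> w' \<in> W \<and> {w, w'} \<in> edges H"
  then show "{Inr (e, w), Inr (e', w')} \<in> edges G"
    using pasted_edge[of e w w'] by (auto simp: paste_def)
qed

text \<open>Each pocket at \<open>a\<close> adds its m - 2 core vertices; the pasted edge itself is
  already counted in \<open>F\<close>.\<close>

lemma degree_Inl: "degree_of G (Inl a) = degree_of F a + card {e \<in> E. a \<in> e} * (m - 2)"
proof -
  have "z \<in> {z. {Inl a, z} \<in> edges G} \<longleftrightarrow>
      z \<in> Inl ` {b. {a, b} \<in> edges F} \<union> Inr ` ({e \<in> E. a \<in> e} \<times> W)" for z
    using adj_Inl_Inl[of a] adj_Inr_Inl[of _ _ a] by (cases z) (auto simp: insert_commute image_iff)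
  then have "{z. {Inl a, z} \<in> edges G} = Inl ` {b. {a, b} \<in> edges F} \<union> Inr ` ({e \<in> E. a \<in> e} \<times> W)"
    by blast
  moreover have "finite {b. {a, b} \<in> edges F}"
  proof (rule finite_subset)
    show "{b. {a, b} \<in> edges F} \<subseteq> verts F" using simple_graph_adjD(2)[OF simple_F] by blast
  qed (use simple_F in \<open>simp add: simple_graph_def\<close>)
  ultimately have "card {z. {Inl a, z} \<in> edges G} =
      card {b. {a, b} \<in> edges F} + card ({e \<in> E. a \<in> e} \<times> W)"
    using finite_E finite_H
    by (simp only:, subst card_Un_disjoint) (auto simp: card_image)
  then show ?thesis
    by (simp only: degree_of_neighbours[OF simple_G] degree_of_neighbours[OF simple_F]
        card_cartesian_product card_W)
qed

lemma degree_Inr: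
  assumes "e \<in> E" "w \<in> W"
  shows "degree_of G (Inr (e, w)) = s + 2"
proof -
  have "z \<in> {z. {Inr (e, w), z} \<in> edges G} \<longleftrightarrow>
      z \<in> Inl ` e \<union> (\<lambda>w'. Inr (e, w')) ` {w' \<in> W. {w, w'} \<in> edges H}" for z
    using adj_Inr_Inl[of e w] adj_Inr_Inr[of e w] assms by (cases z) (auto simp: image_iff)
  then have "{z. {Inr (e, w), z} \<in> edges G} =
      Inl ` e \<union> (\<lambda>w'. Inr (e, w')) ` {w' \<in> W. {w, w'} \<in> edges H}"
    by blast
  moreover have "card e = 2" "finite e"
    using assms E simple_F card_ge_0_finite[of e] by (auto simp: simple_graph_def)
  moreover have "finite {w' \<in> W. {w, w'} \<in> edges H}" using finite_H by simp
  ultimately have "card {z. {Inr (e, w), z} \<in> edges G} = 2 + card {w' \<in> W. {w, w'} \<in> edges H}"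
    by (simp only:, subst card_Un_disjoint) (auto simp: card_image inj_on_def)
  then show ?thesis
    by (simp only: card_core_neighbours[OF assms(2)] degree_of_neighbours[OF simple_G] add.commute)
qed

text \<open>All cores are eliminated at once. In the remaining matrix the number of pasted edges
  containing both \<open>a\<close> and \<open>b\<close> counts the pockets at \<open>a\<close> if a
  = b, and otherwise tells whether {a, b} carries a pocket. Neither the structure of the core nor
  the direction of pasting occurs in it.\<close>

lemma poly_Q_poly_G:
  assumes t: "t \<noteq> 2 + 2 * real s" and as: "distinct as" "set as = verts F"
  shows "poly (Q_poly G) t =
    det (list_mat as as (\<lambda>a b.
        (if a = b then t - real (degree_of F a + card {e \<in> E. a \<in> e} * (m - 2)) else 0)
        - of_bool ({a, b} \<in> edges F)
        - real (card {e \<in> E. a \<in> e \<and> b \<in> e} * (m - 2)) / (t - 2 - 2 * real s)))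
    * core_det t ^ card E"
proof -
  obtain ws where ws: "distinct ws" "set ws = W"
    using finite_distinct_list[of W] finite_H by auto
  obtain es where es: "distinct es" "set es = E"
    using finite_distinct_list[OF finite_E] by auto
  let ?f = "char_entry G t"
  let ?d = "t - 2 - 2 * real s"
  define h :: "'a set \<Rightarrow> 'b \<Rightarrow> 'a + 'a set \<times> 'b" where "h e w = Inr (e, w)" for e w
  define ys where "ys = concat (map (\<lambda>e. map (h e) ws) es)"
  define xs :: "('a + 'a set \<times> 'b) list" where "xs = map Inl as"
  \<comment> \<open>For z = \<open>Inr (e, w)\<close> and x = \<open>Inl a\<close> this is -1 /
    \<open>?d\<close> if a lies on e, and 0 otherwise: on each core a multiple of the all-ones
    vector.\<close>
  define X :: "'a + 'a set \<times> 'b \<Rightarrow> 'a + 'a set \<times> 'b \<Rightarrow> real" where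
    "X z x = - of_bool (projl x \<in> fst (projr z)) / ?d" for z x
  have set_ys: "set ys = Inr ` (E \<times> W)"
    using ws es by (auto simp: ys_def h_def)
  have "ys = map Inr (List.product es ws)"
    unfolding ys_def h_def by (induction es) (auto simp: comp_def)
  then have dist_ys: "distinct ys"
    using es ws by (simp add: distinct_map distinct_product)
  have core: "?f (Inr (e, w)) (Inr (e', w')) = (if e = e' then core_entry t w w' else 0)"
    if "e \<in> E" "w \<in> W" "w' \<in> W" for e e' w w'
    using that adj_Inr_Inr[of e w e' w'] degree_Inr[of e w]
    by (auto simp: char_entry_def core_entry_def)
  have mixed: "?f (Inr (e, w)) (Inl a) = - of_bool (a \<in> e) \<and> ?f (Inl a) (Inr (e, w)) = - of_bool (a \<in> e)"
    if "e \<in> E" "w \<in> W" for e w a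
    using that adj_Inr_Inl[of e w a] by (auto simp: char_entry_def insert_commute)
  have "poly (Q_poly G) t = det (list_mat (xs @ ys) (xs @ ys) ?f)"
    using dist_ys set_ys as unfolding xs_def
    by (intro poly_Q_poly) (auto simp: verts_G distinct_map)
  also have "\<dots> = det (list_mat xs xs (\<lambda>a b. ?f a b - (\<Sum>z\<in>set ys. ?f a z * X z b)))
      * det (list_mat ys ys ?f)"
  proof (rule det_list_mat_Schur[OF dist_ys])
    fix y x assume yx: "y \<in> set ys" "x \<in> set xs"
    obtain e w where y: "y = Inr (e, w)" "e \<in> E" "w \<in> W" using yx set_ys by auto
    obtain a where x: "x = Inl a" using yx by (auto simp: xs_def)
    have "(\<Sum>z\<in>set ys. ?f y z * X z x) = (\<Sum>e'\<in>E. \<Sum>w'\<in>W. ?f y (Inr (e', w')) * X (Inr (e', w')) x)"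
      unfolding set_ys by (subst sum.reindex) (auto simp: sum.cartesian_product comp_def split_beta)
    \<comment> \<open>Cores of different pockets are not adjacent, so only the block of e
      contributes.\<close>
    also have "\<dots> = (\<Sum>e'\<in>E. if e = e' then (\<Sum>w'\<in>W. core_entry t w w') * (- of_bool (a \<in> e) / ?d) else 0)"
      by (intro sum.cong refl)
         (use y x core in \<open>auto simp: X_def sum_negf sum_divide_distrib\<close>)
    also have "\<dots> = (\<Sum>w'\<in>W. core_entry t w w') * (- of_bool (a \<in> e) / ?d)"
      using y finite_E by simp
    also have "\<dots> = ?f y x"
      using core_entry_row_sum[OF y(3), of t] mixed[OF y(2,3), of a] t y x by simp
    finally show "(\<Sum>z\<in>set ys. ?f y z * X z x) = ?f y x" .
  qed
  also have "det (list_mat ys ys ?f) = core_det t ^ card E"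
  proof -
    have "det (list_mat ys ys ?f) = det (list_mat ws ws (core_entry t)) ^ length es"
      unfolding ys_def using es ws core
      by (intro det_list_mat_block_diagonal) (auto simp: h_def)
    then show ?thesis using core_det_list[OF ws] es distinct_card[of es] by simp
  qed
  also have "list_mat xs xs (\<lambda>a b. ?f a b - (\<Sum>z\<in>set ys. ?f a z * X z b)) =
    list_mat as as (\<lambda>a b.
        (if a = b then t - real (degree_of F a + card {e \<in> E. a \<in> e} * (m - 2)) else 0)
        - of_bool ({a, b} \<in> edges F)
        - real (card {e \<in> E. a \<in> e \<and> b \<in> e} * (m - 2)) / ?d)"
    unfolding xs_def list_mat_map
  proof (rule list_mat_cong)
    fix a b
    have "(\<Sum>z\<in>set ys. ?f (Inl a) z * X z (Inl b)) =
        (\<Sum>e\<in>E. \<Sum>w\<in>W. ?f (Inl a) (Inr (e, w)) * X (Inr (e, w)) (Inl b))"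
      unfolding set_ys by (subst sum.reindex) (auto simp: sum.cartesian_product comp_def split_beta)
    \<comment> \<open>The signs of the mixed entry and of \<open>X\<close> cancel; a term survives
      exactly if e contains both vertices.\<close>
    also have "\<dots> = (\<Sum>e\<in>E. \<Sum>w\<in>W. of_bool (a \<in> e \<and> b \<in> e) / ?d)"
      by (intro sum.cong refl) (use mixed in \<open>auto simp: X_def\<close>)
    also have "\<dots> = (\<Sum>e\<in>E. of_bool (a \<in> e \<and> b \<in> e)) * (real (m - 2) / ?d)"
      by (simp add: card_W sum_distrib_left sum_divide_distrib mult.commute)
    also have "(\<Sum>e\<in>E. of_bool (a \<in> e \<and> b \<in> e) :: real) = real (card {e \<in> E. a \<in> e \<and> b \<in> e})"
      using finite_E by (subst sum_of_bool_eq) (auto simp: Int_def)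
    finally show "?f (Inl a) (Inl b) - (\<Sum>z\<in>set ys. ?f (Inl a) z * X z (Inl b)) =
        (if a = b then t - real (degree_of F a + card {e \<in> E. a \<in> e} * (m - 2)) else 0)
        - of_bool ({a, b} \<in> edges F)
        - real (card {e \<in> E. a \<in> e \<and> b \<in> e} * (m - 2)) / ?d"
      using adj_Inl_Inl[of a b] by (auto simp: char_entry_def degree_Inl)
  qed
  finally show ?thesis .
qed

end

section \<open>Comparison of the two graphs for large t\<close>

lemma poly_eq_if_eventually_eq:
  fixes P Q :: "real poly"
  assumes "\<And>t. t > B \<Longrightarrow> poly P t = poly Q t"
  shows "P = Q"
proof (rule ccontr)
  assume "P \<noteq> Q"
  then have "finite {t. poly (P - Q) t = 0}" by (intro poly_roots_finite) simp
  moreover have "{B<..} \<subseteq> {t. poly (P - Q) t = 0}" using assms by auto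
  ultimately show False using infinite_Ioi finite_subset by blast
qed

theorem corollary4p3:
  fixes F :: "'a sgraph" and Ek :: "'a set set" and H K :: "'b sgraph"
    and u v x y :: 'b and n m k r r2 :: nat
    and p q p' q' :: "'a set \<Rightarrow> 'a"
  assumes "simple_graph F" and "card (verts F) = n" and "n \<ge> 2"
    and "Ek \<subseteq> edges F" and "card Ek = k"
    and "regular r (edge_induced Ek)"
    and "simple_graph H" and "card (verts H) = m" and "{u, v} \<in> edges H"
    and "simple_graph K" and "card (verts K) = m" and "{x, y} \<in> edges K"
    and "verts H \<inter> verts K = {}"
    and "degree_of H u = m - 1" and "degree_of H v = m - 1"
    and "degree_of K x = m - 1" and "degree_of K y = m - 1"
    and "regular r2 (delete_verts H {u, v})"
    and "regular r2 (delete_verts K {x, y})"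
    and "m \<ge> 3" and "r2 \<ge> 2"
    and "Q_cospectral H K"
    and "\<forall>e\<in>Ek. e = {p e, q e}" and "\<forall>e\<in>Ek. e = {p' e, q' e}"
  shows "Q_cospectral (edge_pockets F Ek p q H u v) (edge_pockets F Ek p' q' K x y)"
proof -
  interpret H: pocketed_graph H u v m r2 F Ek p q
    by unfold_locales (use assms in \<open>blast\<close>)+
  interpret K: pocketed_graph K x y m r2 F Ek p' q'
    by unfold_locales (use assms in \<open>blast\<close>)+
  obtain as where as: "distinct as" "set as = verts F"
    using finite_distinct_list[of "verts F"] \<open>simple_graph F\<close> by (auto simp: simple_graph_def)
  \<comment> \<open>The bound makes t - 2 - 2 r2 exceed 1, whence 0 \<le> c \<le> m. Its summand 3 m
    covers m + 2 c, which gives 1 + c < t - (m - 1) - c.\<close>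
  have "poly (Q_poly H.G) t = poly (Q_poly K.G) t" if t: "t > 3 + 2 * real r2 + 3 * real m" for t
  proof -
    define c where "c = real (m - 2) / (t - 2 - 2 * real r2)"
    have t_ne: "t \<noteq> 2 + 2 * real r2" using t by simp
    have c0: "c \<ge> 0" using t unfolding c_def by simp
    have "real (m - 2) \<le> real m * 1" by simp
    also have "\<dots> \<le> real m * (t - 2 - 2 * real r2)" using t by (intro mult_left_mono) auto
    finally have c1: "c \<le> real m" using t by (simp add: c_def divide_le_eq)
    let ?b = "(t - real (m - 1) - c)\<^sup>2 - (1 + c)\<^sup>2"
    have "(1 + c)\<^sup>2 < (t - real (m - 1) - c)\<^sup>2"
      using c0 c1 t by (intro power_strict_mono) auto
    then have "?b \<noteq> 0" by simp
    \<comment> \<open>Both sides are the common value at t of the characteristic polynomials of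
      \<open>H\<close> and \<open>K\<close>; the factor \<open>?b\<close> is the same because m and
      r2 are shared.\<close>
    moreover have "?b * H.core_det t = ?b * K.core_det t"
      using H.poly_Q_poly_H[OF t_ne] K.poly_Q_poly_H[OF t_ne] \<open>Q_cospectral H K\<close>
      unfolding Q_cospectral_iff_Q_poly c_def by metis
    ultimately have "H.core_det t = K.core_det t" by simp
    then show ?thesis
      by (simp add: H.poly_Q_poly_G[OF t_ne as] K.poly_Q_poly_G[OF t_ne as])
  qed
  then show ?thesis
    unfolding Q_cospectral_iff_Q_poly by (rule poly_eq_if_eventually_eq)
qed

end
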